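(* Let $\alpha\in(0,1)$ and let $\tau_0(\alpha)$ be the zero in $(-1,0)$ of the function $$C(\tau)=\int_0^{+\infty}\frac{\chi_{(0,1)}(t)\,|1-t|^{\tau}+(1+t)^{\tau}-2}{t^{1+2\alpha}}\,dt,\qquad \tau\in(-1,0).$$ Then $\tau_0(\alpha)=\alpha-1$.
   Context: $\chi_{(0,1)}$ denotes the characteristic function of the interval $(0,1)$. It is known that for each $\alpha\in(0,1)$ the function $C(\cdot)$ has a unique zero in $(-1,0)$; this zero is denoted $\tau_0(\alpha)$. *)

theory Defs
  imports "HOL-Analysis.Analysis"
begin

text \<open>
  For \<open>0 < \<alpha> < 1\<close> and \<open>-1 < \<tau> < 0\<close> the integrand is absolutely integrable on \<open>(0, \<infinity>)\<close>,
  so the default value \<open>0\<close> of the Bochner integral never comes into play. The convention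
  \<open>0 powr \<tau> = 0\<close> matters only at \<open>t = 1\<close>, where the indicator vanishes.
\<close>

definition C :: "real \<Rightarrow> real \<Rightarrow> real" where
  "C \<alpha> \<tau> = (LINT t:{0<..}|lborel.
     (indicator {0<..<1} t * \<bar>1 - t\<bar> powr \<tau> + (1 + t) powr \<tau> - 2) / t powr (1 + 2 * \<alpha>))"

text \<open>
  The description operator specifies a value only because there is exactly one zero in \<open>(-1, 0)\<close>;
  evaluating \<open>tau0 \<alpha>\<close> therefore requires existence and uniqueness of that zero.
\<close>

definition tau0 :: "real \<Rightarrow> real" where
  "tau0 \<alpha> = (THE \<tau>. \<tau> \<in> {-1<..<0} \<and> C \<alpha> \<tau> = 0)"

end

theory Submission
  imports Defs "HOL-Real_Asymp.Real_Asymp"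
begin

text \<open>
  The number \<open>\<alpha> - 1\<close> is the zero because \<open>max 0 x powr (\<alpha> - 1)\<close> is harmonic for the fractional Laplacian
  of order \<open>2 * \<alpha>\<close> on the half-line, and \<open>C \<alpha> \<tau>\<close> is, up to a factor, that operator applied to
  \<open>max 0 x powr \<tau>\<close> at \<open>x = 1\<close>. The vanishing itself has an elementary proof. The integral over
  \<open>t > 0\<close> of the increment \<open>g t = ((1 + t) powr (\<alpha> - 1) - 1) / t powr (1 + 2 * \<alpha>)\<close> is carried to
  \<open>(0, 1)\<close> by \<open>t = s / (1 - s)\<close>, which is inversion of the half-line in the variable \<open>1 + t\<close>. There it
  combines with the left increment \<open>((1 - s) powr (\<alpha> - 1) - 1) / s powr (1 + 2 * \<alpha>)\<close>, and the sum is
  the exact derivative of \<open>(1 - (1 - s) powr \<alpha>)\<^sup>2 / (2 * \<alpha> * s powr (2 * \<alpha>))\<close>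
  (\<open>folded_primitive_derivative\<close>). This primitive climbs from \<open>0\<close> to \<open>1 / (2 * \<alpha>)\<close>, which is exactly
  cancelled by the remaining \<open>-1 / t powr (1 + 2 * \<alpha>)\<close> on \<open>(1, \<infinity>)\<close>, where the point \<open>1 - t\<close> has left the
  half-line.
  
  Neither increment is integrable at \<open>0\<close> when \<open>\<alpha> \<ge> 1 / 2\<close>, so no change of variables is made in the
  integrals. It is made instead in a primitive \<open>G\<close> of \<open>g\<close>: the two copies of \<open>G\<close> enter
  through \<open>G t - G (t / (1 - t))\<close>, and this tends to \<open>0\<close> because its arguments differ by only
  \<open>t\<^sup>2 / (1 - t)\<close> (\<open>primitive_gap_at_zero\<close>). The result is \<open>C_at_critical_exponent\<close>.
  
  Uniqueness comes from convexity in \<open>\<tau>\<close>. The integrand is convex in \<open>\<tau>\<close>, and at \<open>\<tau> = 0\<close> it is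
  \<open>0\<close> on \<open>(0, 1)\<close> and negative on \<open>(1, \<infinity>)\<close>. So to the right of a zero, up to \<open>0\<close>, the function is negative
  (\<open>C_neg_right_of_zero\<close>), and there cannot be two zeros.
\<close>

section \<open>Integrability of the integrand\<close>

text \<open>
  Convexity of \<open>\<sigma> \<mapsto> x powr \<sigma>\<close> between the exponents \<open>0\<close> and \<open>\<sigma>\<close>. Taken at \<open>\<sigma> = -1\<close> it replaces
  fractional powers by reciprocals, which gives the bound near \<open>t = 0\<close>; taken at a zero of \<open>C \<alpha>\<close> it gives
  uniqueness.
\<close>

lemma powr_le_weighted_mean:
  fixes x \<sigma> c :: real
  assumes "x > 0" "0 \<le> c" "c \<le> 1"
  shows "x powr (c * \<sigma>) \<le> c * x powr \<sigma> + (1 - c)"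
  using Youngs_inequality_0[of c "1 - c" "x powr \<sigma>" 1] assms
  by (simp add: powr_powr mult.commute)

definition integrand :: "real \<Rightarrow> real \<Rightarrow> real \<Rightarrow> real" where
  "integrand \<alpha> \<tau> t =
     (indicator {0<..<1} t * \<bar>1 - t\<bar> powr \<tau> + (1 + t) powr \<tau> - 2) / t powr (1 + 2 * \<alpha>)"

lemma C_eq_integral: "C \<alpha> \<tau> = (LINT t:{0<..}|lborel. integrand \<alpha> \<tau> t)"
  by (simp add: C_def integrand_def)

lemma integrand_measurable [measurable]: "integrand \<alpha> \<tau> \<in> borel_measurable borel"
  unfolding integrand_def by measurable

lemma tail_integral:
  fixes \<alpha> :: real
  assumes "\<alpha> > 0"
  shows "set_integrable lborel {1<..} (\<lambda>t::real. t powr (- 1 - 2 * \<alpha>))"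
    and "(LINT t:{1<..}|lborel. t powr (- 1 - 2 * \<alpha>)) = 1 / (2 * \<alpha>)"
proof -
  let ?F = "\<lambda>t::real. - (t powr (- 2 * \<alpha>)) / (2 * \<alpha>)"
  have D: "DERIV ?F x :> x powr (- 1 - 2 * \<alpha>)" if "x > 0" for x
    using that assms by (auto intro!: derivative_eq_intros simp: divide_simps minus_diff_commute)
  have A: "(?F \<longlongrightarrow> ?F 1) (at_right 1)"
    using assms by (intro tendsto_intros) auto
  have B: "(?F \<longlongrightarrow> 0) at_top"
    using assms by real_asymp
  have c: "isCont (\<lambda>t. t powr (- 1 - 2 * \<alpha>)) x" if "x > 0" for x :: real
    using that by (intro continuous_intros) auto
  note * = interval_integral_FTC_nonneg[of "ereal 1" \<infinity> ?F "\<lambda>t. t powr (- 1 - 2 * \<alpha>)" "?F 1" 0]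
  show "set_integrable lborel {1<..} (\<lambda>t::real. t powr (- 1 - 2 * \<alpha>))"
    using *(1) D A B c by (auto simp: ereal_tendsto_simps)
  have "(LBINT x=ereal 1..\<infinity>. x powr (- 1 - 2 * \<alpha>)) = 0 - ?F 1"
    using *(2) D A B c by (auto simp: ereal_tendsto_simps)
  then show "(LINT t:{1<..}|lborel. t powr (- 1 - 2 * \<alpha>)) = 1 / (2 * \<alpha>)"
    by (simp add: interval_lebesgue_integral_def)
qed

lemma powr_integrable_unit_interval:
  fixes p :: real
  assumes "p > -1"
  shows "set_integrable lborel {0<..<1} (\<lambda>t::real. t powr p)"
    and "set_integrable lborel {0<..<1} (\<lambda>t::real. (1 - t) powr p)"
proof -
  let ?F = "\<lambda>t::real. t powr (p + 1) / (p + 1)"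
  have D: "DERIV ?F x :> x powr p" if "x > 0" for x
    using that assms by (auto intro!: derivative_eq_intros simp: divide_simps)
  have D': "DERIV (\<lambda>t. - ?F (1 - t)) x :> (1 - x) powr p" if "x < 1" for x
    using that assms by (auto intro!: derivative_eq_intros simp: divide_simps)
  have cF: "continuous_on {0..} ?F"
    using assms by (auto intro!: continuous_intros continuous_on_powr')
  have cF': "continuous_on {..1} (\<lambda>t. - ?F (1 - t))"
    using assms by (auto intro!: continuous_intros continuous_on_powr')
  have A: "(?F \<longlongrightarrow> ?F 0) (at_right 0)"
    by (rule tendsto_within_subset[OF cF[unfolded continuous_on_def, rule_format]]) auto
  have B: "(?F \<longlongrightarrow> ?F 1) (at_left 1)"
    using assms by (intro tendsto_intros) auto
  have A': "((\<lambda>t. - ?F (1 - t)) \<longlongrightarrow> - ?F (1 - 0)) (at_right 0)"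
    using assms by (intro tendsto_intros) auto
  have B': "((\<lambda>t. - ?F (1 - t)) \<longlongrightarrow> - ?F (1 - 1)) (at_left 1)"
    by (rule tendsto_within_subset[OF cF'[unfolded continuous_on_def, rule_format]]) auto
  have c: "isCont (\<lambda>t. t powr p) x" if "x > 0" for x :: real
    using that by (intro continuous_intros) auto
  have c': "isCont (\<lambda>t. (1 - t) powr p) x" if "x < 1" for x :: real
    using that by (intro continuous_intros) auto
  show "set_integrable lborel {0<..<1} (\<lambda>t::real. t powr p)"
    using interval_integral_FTC_nonneg(1)[of "ereal 0" "ereal 1" ?F "\<lambda>t. t powr p" "?F 0" "?F 1"]
      D A B c by (auto simp: ereal_tendsto_simps)
  show "set_integrable lborel {0<..<1} (\<lambda>t::real. (1 - t) powr p)"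
    using interval_integral_FTC_nonneg(1)[of "ereal 0" "ereal 1" "\<lambda>t. - ?F (1 - t)"
        "\<lambda>t. (1 - t) powr p" "- ?F (1 - 0)" "- ?F (1 - 1)"]
      D' A' B' c' by (auto simp: ereal_tendsto_simps)
qed

text \<open>
  The symmetric sum cancels to second order at \<open>t = 0\<close>. The lower bound is the inequality of arithmetic and
  geometric means with \<open>(1 - t\<^sup>2) powr \<tau> \<ge> 1\<close>; the quadratic upper bound is the explicit value at the
  exponent \<open>-1\<close>, namely \<open>1 / (1 - t) + 1 / (1 + t) - 2 = 2 * t\<^sup>2 / (1 - t\<^sup>2)\<close>. The last bound serves near
  \<open>t = 1\<close>, where the quadratic one is not integrable.
\<close>

lemma symmetric_powr_sum_bounds:
  fixes t \<tau> :: real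
  assumes t: "0 < t" "t < 1" and \<tau>: "-1 < \<tau>" "\<tau> < 0"
  shows "0 \<le> (1 - t) powr \<tau> + (1 + t) powr \<tau> - 2"
    and "(1 - t) powr \<tau> + (1 + t) powr \<tau> - 2 \<le> 2 * t\<^sup>2 / (1 - t\<^sup>2)"
    and "(1 - t) powr \<tau> + (1 + t) powr \<tau> - 2 \<le> (1 - t) powr \<tau>"
proof -
  have lt: "0 < 1 - t\<^sup>2" "1 - t\<^sup>2 < 1"
    using t by (auto simp: power_less_one_iff)
  have "1 \<le> (1 - t\<^sup>2) powr \<tau>"
    using lt \<tau> powr_mono2'[of "\<tau>" "1 - t\<^sup>2" 1] by simp
  also have "(1 - t\<^sup>2) powr \<tau> = ((1 - t) * (1 + t)) powr \<tau>"
    by (simp add: algebra_simps power2_eq_square)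
  also have "\<dots> = (1 - t) powr \<tau> * (1 + t) powr \<tau>"
    using t by (simp add: powr_mult)
  finally have p: "1 \<le> (1 - t) powr \<tau> * (1 + t) powr \<tau>" .
  have "2\<^sup>2 \<le> ((1 - t) powr \<tau> + (1 + t) powr \<tau>)\<^sup>2"
    using p zero_le_power2[of "(1 - t) powr \<tau> - (1 + t) powr \<tau>"]
    by (simp add: power2_eq_square algebra_simps)
  then have "2 \<le> (1 - t) powr \<tau> + (1 + t) powr \<tau>"
    by (rule power2_le_imp_le) simp
  then show "0 \<le> (1 - t) powr \<tau> + (1 + t) powr \<tau> - 2" by simp
  have "(1 - t) powr \<tau> \<le> - \<tau> / (1 - t) + (1 + \<tau>)" "(1 + t) powr \<tau> \<le> - \<tau> / (1 + t) + (1 + \<tau>)"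
    using powr_le_weighted_mean[of "1 - t" "-\<tau>" "-1"] powr_le_weighted_mean[of "1 + t" "-\<tau>" "-1"] t \<tau>
    by (auto simp: powr_minus_divide)
  then have "(1 - t) powr \<tau> + (1 + t) powr \<tau> - 2 \<le> - \<tau> * (1 / (1 - t) + 1 / (1 + t) - 2)"
    by (simp add: algebra_simps)
  also have "1 / (1 - t) + 1 / (1 + t) - 2 = 2 * t\<^sup>2 / (1 - t\<^sup>2)"
  proof -
    have "1 - t\<^sup>2 = (1 - t) * (1 + t)" by (simp add: algebra_simps power2_eq_square)
    then show ?thesis using t by (simp add: divide_simps power2_eq_square)
  qed
  also have "- \<tau> * (2 * t\<^sup>2 / (1 - t\<^sup>2)) \<le> 1 * (2 * t\<^sup>2 / (1 - t\<^sup>2))"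
    using \<tau> lt by (intro mult_right_mono) auto
  finally show "(1 - t) powr \<tau> + (1 + t) powr \<tau> - 2 \<le> 2 * t\<^sup>2 / (1 - t\<^sup>2)" by simp
  have "(1 + t) powr \<tau> \<le> 1"
    using t \<tau> powr_mono2'[of "\<tau>" 1 "1 + t"] by simp
  then show "(1 - t) powr \<tau> + (1 + t) powr \<tau> - 2 \<le> (1 - t) powr \<tau>" by simp
qed

lemma integrand_integrable_unit_interval:
  assumes \<alpha>: "0 < \<alpha>" "\<alpha> < 1" and \<tau>: "-1 < \<tau>" "\<tau> < 0"
  shows "set_integrable lborel {0<..<1} (integrand \<alpha> \<tau>)"
proof (rule set_integrable_bound)
  \<comment> \<open>The first summand dominates on \<open>t < 1 / 2\<close>, the second one on \<open>t \<ge> 1 / 2\<close>, where \<open>t powr (1 + 2 * \<alpha>) \<ge> 1 / 8\<close>.\<close>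
  let ?D = "\<lambda>t::real. 8 * t powr (1 - 2 * \<alpha>) + 8 * (1 - t) powr \<tau>"
  show "set_integrable lborel {0<..<1} ?D"
    using \<alpha> \<tau> powr_integrable_unit_interval(1)[of "1 - 2 * \<alpha>"] powr_integrable_unit_interval(2)[of \<tau>]
    by (intro set_integral_add set_integrable_mult_right) auto
  show "set_borel_measurable lborel {0<..<1} (integrand \<alpha> \<tau>)"
    unfolding set_borel_measurable_def by measurable
  have "\<bar>integrand \<alpha> \<tau> t\<bar> \<le> \<bar>?D t\<bar>" if t: "0 < t" "t < 1" for t
  proof -
    let ?N = "(1 - t) powr \<tau> + (1 + t) powr \<tau> - 2"
    note N = symmetric_powr_sum_bounds[OF t \<tau>]
    have I: "\<bar>integrand \<alpha> \<tau> t\<bar> = ?N / t powr (1 + 2 * \<alpha>)"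
      using t N(1) by (simp add: integrand_def)
    have "?N / t powr (1 + 2 * \<alpha>) \<le> ?D t"
    proof (cases "t < 1/2")
      case True
      have "t\<^sup>2 \<le> (1/2)\<^sup>2" using True t by (intro power_mono) auto
      then have "2 * t\<^sup>2 / (1 - t\<^sup>2) \<le> 2 * t\<^sup>2 / (1/4)"
        by (intro divide_left_mono) (auto simp: power2_eq_square)
      with N(2) have "?N \<le> 8 * t\<^sup>2" by simp
      then have "?N / t powr (1 + 2 * \<alpha>) \<le> 8 * t\<^sup>2 / t powr (1 + 2 * \<alpha>)"
        by (rule divide_right_mono) simp
      also have "\<dots> = 8 * t powr (1 - 2 * \<alpha>)"
      proof -
        have "t\<^sup>2 / t powr (1 + 2 * \<alpha>) = t powr (2 - (1 + 2 * \<alpha>))"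
          using t by (simp only: powr_diff) (simp add: powr_numeral)
        then show ?thesis by simp
      qed
      finally show ?thesis using t by (simp add: add_increasing2)
    next
      case False
      have "(1/2) powr 3 \<le> t powr 3" using False by (intro powr_mono2) auto
      also have "\<dots> \<le> t powr (1 + 2 * \<alpha>)" using t \<alpha> by (intro powr_mono') auto
      finally have "1 / 8 \<le> t powr (1 + 2 * \<alpha>)" by (simp add: powr_numeral power3_eq_cube)
      then have "?N / t powr (1 + 2 * \<alpha>) \<le> ?N / (1 / 8)"
        using N(1) t by (intro divide_left_mono) auto
      also have "\<dots> \<le> 8 * (1 - t) powr \<tau>" using N(3) by simp
      finally show ?thesis by (simp add: add_increasing)
    qed
    then show ?thesis unfolding I by linarith
  qed
  then show "AE x in lborel. x \<in> {0<..<1} \<longrightarrow> norm (integrand \<alpha> \<tau> x) \<le> norm (?D x)"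
    by auto
qed

lemma integrand_integrable_tail:
  assumes \<alpha>: "0 < \<alpha>" and \<tau>: "\<tau> < 0"
  shows "set_integrable lborel {1<..} (integrand \<alpha> \<tau>)"
proof (rule set_integrable_bound)
  let ?D = "\<lambda>t::real. 2 * t powr (- 1 - 2 * \<alpha>)"
  show "set_integrable lborel {1<..} ?D"
    using tail_integral(1)[OF \<alpha>] by (rule set_integrable_mult_right)
  show "set_borel_measurable lborel {1<..} (integrand \<alpha> \<tau>)"
    unfolding set_borel_measurable_def by measurable
  have "\<bar>integrand \<alpha> \<tau> t\<bar> \<le> ?D t" if t: "1 < t" for t
  proof -
    have "(1 + t) powr \<tau> \<le> 1"
      using t \<tau> powr_mono2'[of "\<tau>" 1 "1 + t"] by simp
    then have "\<bar>(1 + t) powr \<tau> - 2\<bar> \<le> 2" by (simp add: abs_if)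
    then have "\<bar>integrand \<alpha> \<tau> t\<bar> \<le> 2 / t powr (1 + 2 * \<alpha>)"
      using t by (simp add: integrand_def divide_right_mono)
    also have "\<dots> = ?D t"
      using powr_minus_divide[of t "1 + 2 * \<alpha>"] by simp
    finally show ?thesis .
  qed
  then show "AE x in lborel. x \<in> {1<..} \<longrightarrow> norm (integrand \<alpha> \<tau> x) \<le> norm (?D x)"
    by auto
qed

lemma C_split:
  assumes "0 < \<alpha>" "\<alpha> < 1" "-1 < \<tau>" "\<tau> < 0"
  shows "C \<alpha> \<tau> = (LINT t:{0<..<1}|lborel. integrand \<alpha> \<tau> t)
    + (LINT t:{1<..}|lborel. integrand \<alpha> \<tau> t)"
proof -
  have "C \<alpha> \<tau> = (LINT t:{0<..<1} \<union> {1<..}|lborel. integrand \<alpha> \<tau> t)"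
    unfolding C_eq_integral
  proof (rule set_integral_cong_set)
    show "AE x in lborel. (x \<in> {0<..<1} \<union> {1<..}) = (x \<in> {0::real<..})"
      using AE_lborel_singleton[of "1::real"] by eventually_elim auto
  qed (auto simp: set_borel_measurable_def)
  also have "\<dots> = (LINT t:{0<..<1}|lborel. integrand \<alpha> \<tau> t)
    + (LINT t:{1<..}|lborel. integrand \<alpha> \<tau> t)"
    using assms integrand_integrable_unit_interval integrand_integrable_tail
    by (intro set_integral_Un) auto
  finally show ?thesis .
qed

section \<open>Uniqueness of the zero\<close>

text \<open>
  With \<open>\<tau> = c * \<sigma>\<close>, convexity bounds the integrand at \<open>\<tau>\<close> by \<open>c\<close> times the integrand at \<open>\<sigma>\<close> plus
  \<open>1 - c\<close> times the one at exponent \<open>0\<close>. The latter is \<open>- (t powr (- 1 - 2 * \<alpha>))\<close> on \<open>(1, \<infinity>)\<close>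
  and vanishes on \<open>(0, 1)\<close>, so \<open>C \<alpha> \<tau> \<le> c * C \<alpha> \<sigma> - (1 - c) / (2 * \<alpha>)\<close>.
\<close>

lemma C_neg_right_of_zero:
  assumes \<alpha>: "0 < \<alpha>" "\<alpha> < 1" and \<tau>: "-1 < \<sigma>" "\<sigma> < \<tau>" "\<tau> < 0" and "C \<alpha> \<sigma> = 0"
  shows "C \<alpha> \<tau> < 0"
proof -
  define c where "c = \<tau> / \<sigma>"
  have c: "0 \<le> c" "c < 1" "\<tau> = c * \<sigma>"
    using \<tau> by (auto simp: c_def divide_simps)
  have \<sigma>: "\<sigma> < 0" "-1 < \<tau>" using \<tau> by auto
  note i0 = integrand_integrable_unit_interval[OF \<alpha>] and i1 = integrand_integrable_tail[OF \<alpha>(1)]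
  have p: "x powr \<tau> \<le> c * x powr \<sigma> + (1 - c)" if "x > 0" for x
    using powr_le_weighted_mean[of x c \<sigma>] that c by auto
  have "(LINT t:{0<..<1}|lborel. integrand \<alpha> \<tau> t) \<le> (LINT t:{0<..<1}|lborel. c * integrand \<alpha> \<sigma> t)"
  proof (rule set_integral_mono)
    fix t :: real assume t: "t \<in> {0<..<1}"
    have "(1 - t) powr \<tau> + (1 + t) powr \<tau> - 2 \<le> c * ((1 - t) powr \<sigma> + (1 + t) powr \<sigma> - 2)"
      using p[of "1 - t"] p[of "1 + t"] t by (simp add: algebra_simps)
    then show "integrand \<alpha> \<tau> t \<le> c * integrand \<alpha> \<sigma> t"
      using t by (simp add: integrand_def divide_right_mono)
  qed (use i0 \<tau> \<sigma> in auto)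
  also have "\<dots> = c * (LINT t:{0<..<1}|lborel. integrand \<alpha> \<sigma> t)" by simp
  finally have 1: "(LINT t:{0<..<1}|lborel. integrand \<alpha> \<tau> t) \<le> c * (LINT t:{0<..<1}|lborel. integrand \<alpha> \<sigma> t)" .
  have "(LINT t:{1<..}|lborel. integrand \<alpha> \<tau> t)
    \<le> (LINT t:{1<..}|lborel. c * integrand \<alpha> \<sigma> t - (1 - c) * t powr (- 1 - 2 * \<alpha>))"
  proof (rule set_integral_mono)
    fix t :: real assume t: "t \<in> {1<..}"
    have "(1 + t) powr \<tau> - 2 \<le> c * ((1 + t) powr \<sigma> - 2) - (1 - c)"
      using p[of "1 + t"] t by (simp add: algebra_simps)
    then have "((1 + t) powr \<tau> - 2) / t powr (1 + 2 * \<alpha>)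
        \<le> (c * ((1 + t) powr \<sigma> - 2) - (1 - c)) / t powr (1 + 2 * \<alpha>)"
      by (rule divide_right_mono) simp
    then show "integrand \<alpha> \<tau> t \<le> c * integrand \<alpha> \<sigma> t - (1 - c) * t powr (- 1 - 2 * \<alpha>)"
      using t powr_minus_divide[of t "1 + 2 * \<alpha>"] by (simp add: integrand_def diff_divide_distrib right_diff_distrib)
  qed (use i1 \<tau> \<sigma> tail_integral(1)[OF \<alpha>(1)] in auto)
  also have "\<dots> = c * (LINT t:{1<..}|lborel. integrand \<alpha> \<sigma> t) - (1 - c) / (2 * \<alpha>)"
    using i1[of \<sigma>] \<sigma> tail_integral[OF \<alpha>(1)] by (subst set_integral_diff) auto
  finally have "C \<alpha> \<tau> \<le> c * C \<alpha> \<sigma> - (1 - c) / (2 * \<alpha>)"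
    using 1 \<alpha> \<tau> \<sigma> by (simp add: C_split algebra_simps)
  moreover have "0 < (1 - c) / (2 * \<alpha>)" using c \<alpha> by simp
  ultimately show ?thesis using \<open>C \<alpha> \<sigma> = 0\<close> by simp
qed

section \<open>The right increment and its inversion\<close>

definition right_increment :: "real \<Rightarrow> real \<Rightarrow> real" where
  "right_increment \<alpha> t = ((1 + t) powr (\<alpha> - 1) - 1) / t powr (1 + 2 * \<alpha>)"

lemma isCont_right_increment: "t > 0 \<Longrightarrow> isCont (right_increment \<alpha>) t"
  unfolding right_increment_def by (intro continuous_intros) auto

lemma right_increment_nonpos:
  assumes \<alpha>: "\<alpha> < 1" and "t > 0"
  shows "right_increment \<alpha> t \<le> 0"
  using assms powr_mono2'[of "\<alpha> - 1" 1 "1 + t"] unfolding right_increment_def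
  by (intro divide_nonpos_nonneg) auto

text \<open>
  The two lower bounds control a primitive at the two ends. This one is integrable at infinity; the singularity
  of the next one at \<open>0\<close> is compensated by an interval of length of order \<open>t\<^sup>2\<close>.
\<close>

lemma right_increment_ge_far:
  assumes "t > 0"
  shows "- (t powr (- 1 - 2 * \<alpha>)) \<le> right_increment \<alpha> t"
  using assms powr_minus_divide[of t "1 + 2 * \<alpha>"] unfolding right_increment_def
  by (simp add: divide_simps)

lemma right_increment_ge_near:
  assumes \<alpha>: "0 < \<alpha>" and t: "t > 0"
  shows "- (t powr (- 2 * \<alpha>)) \<le> right_increment \<alpha> t"
proof -
  have "1 - t \<le> 1 / (1 + t)" using t by (simp add: divide_simps algebra_simps)
  also have "\<dots> = (1 + t) powr (-1)" using t by (simp add: powr_minus_divide)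
  also have "\<dots> \<le> (1 + t) powr (\<alpha> - 1)" using t \<alpha> by (intro powr_mono) auto
  finally have "- t / t powr (1 + 2 * \<alpha>) \<le> right_increment \<alpha> t"
    unfolding right_increment_def by (intro divide_right_mono) auto
  also have "- t / t powr (1 + 2 * \<alpha>) = - (t powr (- 2 * \<alpha>))"
    using t powr_minus_divide[of t "2 * \<alpha>"] by (simp add: powr_add)
  finally show ?thesis .
qed

text \<open>
  The substitution \<open>s = t / (1 - t)\<close>, with its Jacobian \<open>1 / (1 - t)\<^sup>2\<close>. Since \<open>1 + s = 1 / (1 - t)\<close>, it
  inverts the variable \<open>1 + s\<close>, and the same denominator as for the left increment reappears.
\<close>

lemma right_increment_reflect:
  fixes t \<alpha> :: real
  assumes t: "0 < t" "t < 1"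
  shows "right_increment \<alpha> (t / (1 - t)) / (1 - t)\<^sup>2
    = ((1 - t) powr \<alpha> - (1 - t) powr (2 * \<alpha> - 1)) / t powr (1 + 2 * \<alpha>)"
proof -
  have "1 + t / (1 - t) = 1 / (1 - t)" using t by (simp add: divide_simps)
  then have 1: "(1 + t / (1 - t)) powr (\<alpha> - 1) = (1 - t) powr (1 - \<alpha>)"
    using t powr_minus[of "1 - t" "\<alpha> - 1"] by (simp add: powr_divide inverse_eq_divide)
  have 2: "(t / (1 - t)) powr (1 + 2 * \<alpha>) = t powr (1 + 2 * \<alpha>) / (1 - t) powr (1 + 2 * \<alpha>)"
    using t by (simp add: powr_divide)
  have 3: "(1 - t) powr (1 + 2 * \<alpha>) / (1 - t)\<^sup>2 = (1 - t) powr (2 * \<alpha> - 1)"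
    using t powr_diff[of "1 - t" "1 + 2 * \<alpha>" 2] by (simp add: powr_numeral)
  have 4: "(1 - t) powr (1 - \<alpha>) * (1 - t) powr (2 * \<alpha> - 1) = (1 - t) powr \<alpha>"
    using t by (simp add: powr_add[symmetric])
  have "right_increment \<alpha> (t / (1 - t)) / (1 - t)\<^sup>2 = ((1 - t) powr (1 - \<alpha>) - 1) *
      ((1 - t) powr (1 + 2 * \<alpha>) / (1 - t)\<^sup>2) / t powr (1 + 2 * \<alpha>)"
    unfolding right_increment_def 1 2 by simp
  then show ?thesis unfolding 3 by (simp add: left_diff_distrib 4)
qed

text \<open>
  The exponent \<open>\<alpha> - 1\<close> is special here. With \<open>v = 1 - t\<close>, the numerator of the derivative factors as
  \<open>(v powr (\<alpha> - 1) - 1) * (1 - v powr \<alpha>)\<close>. The quotient rule produces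
  \<open>1 - v powr \<alpha>\<close> times \<open>v powr (\<alpha> - 1) * t - (1 - v powr \<alpha>)\<close>, and the second factor is
  \<open>v powr (\<alpha> - 1) - 1\<close> because \<open>t = 1 - v\<close>.
\<close>

lemma folded_primitive_derivative:
  fixes t \<alpha> :: real
  assumes t: "0 < t" "t < 1" and \<alpha>: "0 < \<alpha>"
  shows "((\<lambda>t. (1 - (1 - t) powr \<alpha>)\<^sup>2 / (2 * \<alpha> * t powr (2 * \<alpha>))) has_real_derivative
    (((1 - t) powr (\<alpha> - 1) - 1) + ((1 - t) powr \<alpha> - (1 - t) powr (2 * \<alpha> - 1))) / t powr (1 + 2 * \<alpha>)) (at t)"
proof -
  define u where "u = (1 - t) powr (\<alpha> - 1)"
  define v where "v = t powr (2 * \<alpha>)"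
  have v: "v > 0" using t by (simp add: v_def)
  have 1: "(1 - t) powr \<alpha> = (1 - t) * u"
    using t powr_add[of "1 - t" 1 "\<alpha> - 1"] by (simp add: u_def)
  have 2: "(1 - t) powr (2 * \<alpha> - 1) = (1 - t) * u\<^sup>2"
    using t powr_add[of "1 - t" 1 "(\<alpha> - 1) + (\<alpha> - 1)"] powr_add[of "1 - t" "\<alpha> - 1" "\<alpha> - 1"]
    by (simp add: u_def power2_eq_square algebra_simps)
  have 3: "t powr (1 + 2 * \<alpha>) = t * v" "t powr (2 * \<alpha> - 1) = v / t"
    using t by (simp_all add: v_def powr_add powr_diff)
  have "((\<lambda>t. (1 - (1 - t) powr \<alpha>)\<^sup>2 / (2 * \<alpha> * t powr (2 * \<alpha>))) has_real_derivative
     (2 * (1 - (1 - t) * u) * (\<alpha> * u) * (2 * \<alpha> * v) - (1 - (1 - t) * u)\<^sup>2 * (2 * \<alpha> * (2 * \<alpha> * (v / t))))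
       / (2 * \<alpha> * v)\<^sup>2) (at t)"
    using t \<alpha> v
    by (auto intro!: derivative_eq_intros simp: 1 3 u_def[symmetric] v_def[symmetric] power2_eq_square)
      (simp add: algebra_simps)
  also have "(2 * (1 - (1 - t) * u) * (\<alpha> * u) * (2 * \<alpha> * v) - (1 - (1 - t) * u)\<^sup>2 * (2 * \<alpha> * (2 * \<alpha> * (v / t))))
       / (2 * \<alpha> * v)\<^sup>2 = ((u - 1) + ((1 - t) * u - (1 - t) * u\<^sup>2)) / (t * v)"
    using t \<alpha> v by (simp add: divide_simps) (simp add: algebra_simps power2_eq_square)
  finally show ?thesis unfolding 1 2 3 u_def[symmetric] .
qed

text \<open>
  Since \<open>1 - t \<le> (1 - t) powr \<alpha>\<close>, the numerator is at most \<open>t\<^sup>2\<close>, which beats \<open>t powr (2 * \<alpha>)\<close>.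
\<close>

lemma folded_primitive_at_zero:
  fixes \<alpha> :: real
  assumes \<alpha>: "0 < \<alpha>" "\<alpha> < 1"
  shows "((\<lambda>t. (1 - (1 - t) powr \<alpha>)\<^sup>2 / (2 * \<alpha> * t powr (2 * \<alpha>))) \<longlongrightarrow> 0) (at_right 0)"
    (is "(?\<Phi> \<longlongrightarrow> 0) _")
proof -
  have ev: "eventually (\<lambda>t::real. 0 < t \<and> t < 1) (at_right 0)"
    using eventually_at_right_real[of 0 1] by simp
  show ?thesis
  proof (rule tendsto_sandwich[where f = "\<lambda>_. 0"])
    show "((\<lambda>t. t powr (2 - 2 * \<alpha>) / (2 * \<alpha>)) \<longlongrightarrow> 0) (at_right 0)"
      using \<alpha> by real_asymp
    show "eventually (\<lambda>t. ?\<Phi> t \<le> t powr (2 - 2 * \<alpha>) / (2 * \<alpha>)) (at_right 0)"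
      using ev
    proof eventually_elim
      fix t :: real assume t: "0 < t \<and> t < 1"
      have "1 - t \<le> (1 - t) powr \<alpha>" "(1 - t) powr \<alpha> \<le> 1"
        using t \<alpha> powr_mono'[of \<alpha> 1 "1 - t"] by (auto simp: powr_le1)
      then have "(1 - (1 - t) powr \<alpha>)\<^sup>2 \<le> t\<^sup>2" by (intro power_mono) auto
      then have "?\<Phi> t \<le> t\<^sup>2 / (2 * \<alpha> * t powr (2 * \<alpha>))"
        using \<alpha> by (intro divide_right_mono) auto
      also have "\<dots> = t powr (2 - 2 * \<alpha>) / (2 * \<alpha>)"
        using t \<alpha> by (simp add: powr_diff powr_numeral)
      finally show "?\<Phi> t \<le> t powr (2 - 2 * \<alpha>) / (2 * \<alpha>)" .
    qed
  qed (use \<alpha> in auto)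
qed

section \<open>A primitive of the right increment\<close>

text \<open>
  \<open>G\<close> itself may diverge at \<open>0\<close>. By the mean value theorem the difference is \<open>t\<^sup>2 / (1 - t)\<close> times a value of
  the increment of size at most \<open>t powr (- 2 * \<alpha>)\<close>, hence of order \<open>t powr (2 - 2 * \<alpha>)\<close>.
\<close>

lemma primitive_gap_at_zero:
  assumes \<alpha>: "0 < \<alpha>" "\<alpha> < 1"
    and G: "\<And>t. t > 0 \<Longrightarrow> (G has_real_derivative right_increment \<alpha> t) (at t)"
  shows "((\<lambda>t. G t - G (t / (1 - t))) \<longlongrightarrow> 0) (at_right 0)"
proof -
  have ev: "eventually (\<lambda>t::real. 0 < t \<and> t < 1) (at_right 0)"
    using eventually_at_right_real[of 0 1] by simp
  show ?thesis
  proof (rule tendsto_sandwich[where f = "\<lambda>_. 0"])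
    show "((\<lambda>t. t powr (2 - 2 * \<alpha>) / (1 - t)) \<longlongrightarrow> 0) (at_right 0)"
      using \<alpha> by real_asymp
    have main: "0 \<le> G t - G (t / (1 - t)) \<and> G t - G (t / (1 - t)) \<le> t powr (2 - 2 * \<alpha>) / (1 - t)"
      if t: "0 < t \<and> t < 1" for t
    proof -
      have lt: "t < t / (1 - t)" using t by (simp add: divide_simps)
      obtain z where z: "t < z" "z < t / (1 - t)" "G (t / (1 - t)) - G t = (t / (1 - t) - t) * right_increment \<alpha> z"
        using MVT2[OF lt, of G "right_increment \<alpha>"] G t by force
      have d: "t / (1 - t) - t = t\<^sup>2 / (1 - t)"
        using t by (simp add: divide_simps power2_eq_square algebra_simps)
      have "- right_increment \<alpha> z \<le> z powr (- 2 * \<alpha>)" using right_increment_ge_near[OF \<alpha>(1), of z] z t by simp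
      also have "\<dots> \<le> t powr (- 2 * \<alpha>)" using z t \<alpha> by (intro powr_mono2') auto
      finally have "t\<^sup>2 / (1 - t) * (- right_increment \<alpha> z) \<le> t\<^sup>2 / (1 - t) * t powr (- 2 * \<alpha>)"
        using t by (intro mult_left_mono) auto
      also have "\<dots> = t powr (2 - 2 * \<alpha>) / (1 - t)"
        using t powr_add[of t 2 "- 2 * \<alpha>"] by (simp add: powr_numeral)
      finally have "G t - G (t / (1 - t)) \<le> t powr (2 - 2 * \<alpha>) / (1 - t)"
        using z(3) d by simp
      moreover have "0 \<le> t\<^sup>2 / (1 - t) * (- right_increment \<alpha> z)"
        using right_increment_nonpos[OF \<alpha>(2), of z] z t by (intro mult_nonneg_nonneg) auto
      ultimately show ?thesis using z(3) d by simp
    qed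
    show "eventually (\<lambda>t. G t - G (t / (1 - t)) \<le> t powr (2 - 2 * \<alpha>) / (1 - t)) (at_right 0)"
      using ev by eventually_elim (use main in blast)
    show "eventually (\<lambda>t. 0 \<le> G t - G (t / (1 - t))) (at_right 0)"
      using ev by eventually_elim (use main in blast)
  qed auto
qed

lemma monotone_bounded_tendsto_at_top:
  fixes f :: "real \<Rightarrow> real"
  assumes mono: "\<And>x y. a \<le> x \<Longrightarrow> x \<le> y \<Longrightarrow> f x \<le> f y" and bd: "\<And>x. a \<le> x \<Longrightarrow> f x \<le> B"
  shows "\<exists>L. (f \<longlongrightarrow> L) at_top"
proof -
  let ?h = "\<lambda>x. f (max a x)"
  have m: "mono ?h" by (auto intro!: monoI mono)
  have "incseq (\<lambda>n. ?h (real n))" by (auto intro!: monoI mono)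
  moreover have "\<forall>n. ?h (real n) \<le> B" using bd by auto
  ultimately obtain L where "(\<lambda>n. ?h (real n)) \<longlonglongrightarrow> L"
    by (rule incseq_convergent)
  then have "(?h \<longlongrightarrow> L) at_top" by (rule tendsto_at_topI_sequentially_real[OF m])
  moreover have "eventually (\<lambda>x. ?h x = f x) at_top"
    using eventually_ge_at_top[of a] by eventually_elim (simp add: max_def)
  ultimately have "(f \<longlongrightarrow> L) at_top"
    using tendsto_cong[of ?h f at_top L] by simp
  then show ?thesis ..
qed

text \<open>
  \<open>G\<close> decreases, while \<open>G t - t powr (- 2 * \<alpha>) / (2 * \<alpha>)\<close> increases; so \<open>G\<close> is bounded below.
\<close>

lemma primitive_tail_limit:
  assumes \<alpha>: "0 < \<alpha>" "\<alpha> < 1"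
    and G: "\<And>t. t > 0 \<Longrightarrow> (G has_real_derivative right_increment \<alpha> t) (at t)"
  shows "\<exists>L. (G \<longlongrightarrow> L) at_top"
proof -
  have "\<exists>L. ((\<lambda>t. - G t) \<longlongrightarrow> L) at_top"
  proof (rule monotone_bounded_tendsto_at_top)
    show "- G x \<le> - G y" if "1 \<le> x" "x \<le> y" for x y
      using that by (intro DERIV_nonneg_imp_nondecreasing[of x y "\<lambda>t. - G t"])
        (auto intro!: exI derivative_eq_intros G right_increment_nonpos \<alpha>)
    show "- G x \<le> - G 1 + 1 / (2 * \<alpha>)" if "1 \<le> x" for x
    proof -
      have "G 1 - 1 powr (- 2 * \<alpha>) / (2 * \<alpha>) \<le> G x - x powr (- 2 * \<alpha>) / (2 * \<alpha>)"
      proof (rule DERIV_nonneg_imp_nondecreasing[OF that])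
        fix y :: real assume "1 \<le> y" "y \<le> x"
        then have "((\<lambda>t. G t - t powr (- 2 * \<alpha>) / (2 * \<alpha>)) has_real_derivative
            right_increment \<alpha> y + y powr (- 1 - 2 * \<alpha>)) (at y)"
          using \<alpha> by (auto intro!: derivative_eq_intros G simp: algebra_simps minus_diff_commute)
        then show "\<exists>d. ((\<lambda>t. G t - t powr (- 2 * \<alpha>) / (2 * \<alpha>)) has_real_derivative d) (at y) \<and> 0 \<le> d"
          using right_increment_ge_far[of y \<alpha>] \<open>1 \<le> y\<close> by (auto intro!: exI)
      qed
      moreover have "0 \<le> x powr (- 2 * \<alpha>) / (2 * \<alpha>)" using \<alpha> by simp
      ultimately show ?thesis by simp
    qed
  qed
  then show ?thesis by (metis tendsto_minus_cancel_left)
qed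

section \<open>Vanishing at the critical exponent\<close>

lemma integral_above_one:
  assumes \<alpha>: "0 < \<alpha>" "\<alpha> < 1"
    and G: "\<And>t. t > 0 \<Longrightarrow> (G has_real_derivative right_increment \<alpha> t) (at t)"
    and L: "(G \<longlongrightarrow> L) at_top"
  shows "(LINT t:{1<..}|lborel. integrand \<alpha> (\<alpha> - 1) t) = L - (G 1 + 1 / (2 * \<alpha>))"
proof -
  let ?Q = "\<lambda>t. G t + t powr (- 2 * \<alpha>) / (2 * \<alpha>)"
  let ?f = "\<lambda>t. right_increment \<alpha> t - t powr (- 1 - 2 * \<alpha>)"
  have eq: "integrand \<alpha> (\<alpha> - 1) t = ?f t" if "t > 1" for t
    using that powr_minus_divide[of t "1 + 2 * \<alpha>"]
    by (simp add: integrand_def right_increment_def diff_divide_distrib)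
  have "(LBINT t=ereal 1..\<infinity>. ?f t) = L - (G 1 + 1 / (2 * \<alpha>))"
  proof (rule interval_integral_FTC_integrable[where F = ?Q])
    show "(?Q has_vector_derivative ?f x) (at x)" if "ereal 1 < ereal x" for x
      using that \<alpha> unfolding has_real_derivative_iff_has_vector_derivative[symmetric]
      by (auto intro!: derivative_eq_intros G simp: algebra_simps minus_diff_commute)
    show "isCont ?f x" if "ereal 1 < ereal x" for x
      using that by (auto intro!: continuous_intros isCont_right_increment)
    have "set_integrable lborel {1<..} ?f \<longleftrightarrow> set_integrable lborel {1<..} (integrand \<alpha> (\<alpha> - 1))"
      by (rule set_integrable_cong) (auto simp: eq)
    then show "set_integrable lborel (einterval (ereal 1) \<infinity>) ?f"
      using integrand_integrable_tail[of \<alpha> "\<alpha> - 1"] \<alpha> by simp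
    have "isCont ?Q 1"
      using \<alpha> by (intro DERIV_isCont[where D = "?f 1"]) (auto intro!: derivative_eq_intros G simp: algebra_simps minus_diff_commute)
    then show "((?Q \<circ> real_of_ereal) \<longlongrightarrow> G 1 + 1 / (2 * \<alpha>)) (at_right (ereal 1))"
      unfolding isCont_def ereal_tendsto_simps by (auto intro: tendsto_within_subset)
    have "(?Q \<longlongrightarrow> L + 0 / (2 * \<alpha>)) at_top"
      using \<alpha> by (intro tendsto_intros L tendsto_neg_powr filterlim_ident) auto
    then show "((?Q \<circ> real_of_ereal) \<longlongrightarrow> L) (at_left \<infinity>)"
      unfolding ereal_tendsto_simps by simp
  qed simp
  then have "(LBINT t=ereal 1..\<infinity>. integrand \<alpha> (\<alpha> - 1) t) = L - (G 1 + 1 / (2 * \<alpha>))"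
    by (subst interval_integral_cong[where g = ?f]) (auto simp: eq)
  then show ?thesis
    by (simp add: interval_integral_to_infinity_eq)
qed

text \<open>
  The left increment is the derivative of the folded primitive minus the inverted right increment, that is,
  minus the derivative of \<open>G (t / (1 - t))\<close>. As \<open>t\<close> tends to \<open>1\<close>, the argument \<open>t / (1 - t)\<close> runs to
  infinity, so the value \<open>L\<close> of \<open>G\<close> at infinity enters here with the sign opposite to that in
  \<open>integral_above_one\<close>.
\<close>

lemma integral_below_one:
  assumes \<alpha>: "0 < \<alpha>" "\<alpha> < 1"
    and G: "\<And>t. t > 0 \<Longrightarrow> (G has_real_derivative right_increment \<alpha> t) (at t)"
    and L: "(G \<longlongrightarrow> L) at_top"
  shows "(LINT t:{0<..<1}|lborel. integrand \<alpha> (\<alpha> - 1) t) = 1 / (2 * \<alpha>) + (G 1 - L)"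
proof -
  let ?\<Phi> = "\<lambda>t. (1 - (1 - t) powr \<alpha>)\<^sup>2 / (2 * \<alpha> * t powr (2 * \<alpha>))"
  let ?P = "\<lambda>t. ?\<Phi> t + (G t - G (t / (1 - t)))"
  let ?f = "\<lambda>t. ((1 - t) powr (\<alpha> - 1) - 1) / t powr (1 + 2 * \<alpha>) + right_increment \<alpha> t"
  have eq: "integrand \<alpha> (\<alpha> - 1) t = ?f t" if "0 < t" "t < 1" for t
    using that by (simp add: integrand_def right_increment_def diff_divide_distrib add_divide_distrib)
  have "(LBINT t=ereal 0..ereal 1. ?f t) = (1 / (2 * \<alpha>) + (G 1 - L)) - 0"
  proof (rule interval_integral_FTC_integrable[where F = ?P])
    show "(?P has_vector_derivative ?f t) (at t)" if "ereal 0 < ereal t" "ereal t < ereal 1" for t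
    proof -
      have t: "0 < t" "t < 1" using that by auto
      have "((\<lambda>t. t / (1 - t)) has_real_derivative 1 / (1 - t)\<^sup>2) (at t)"
        using t by (auto intro!: derivative_eq_intros simp: power2_eq_square)
      with G[of "t / (1 - t)"] t
      have "((\<lambda>t. G (t / (1 - t))) has_real_derivative right_increment \<alpha> (t / (1 - t)) * (1 / (1 - t)\<^sup>2)) (at t)"
        by (intro DERIV_chain2[of G]) auto
      note deriv = DERIV_add[OF folded_primitive_derivative[OF t \<alpha>(1)] DERIV_diff[OF G[OF t(1)] this]]
      show ?thesis
        unfolding has_real_derivative_iff_has_vector_derivative[symmetric]
        by (rule DERIV_cong[OF deriv]) (simp add: right_increment_reflect[OF t] add_divide_distrib)
    qed
    show "isCont ?f t" if "ereal 0 < ereal t" "ereal t < ereal 1" for t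
      using that by (auto intro!: continuous_intros isCont_right_increment)
    have "set_integrable lborel {0<..<1} ?f \<longleftrightarrow> set_integrable lborel {0<..<1} (integrand \<alpha> (\<alpha> - 1))"
      by (rule set_integrable_cong) (auto simp: eq)
    then show "set_integrable lborel (einterval (ereal 0) (ereal 1)) ?f"
      using integrand_integrable_unit_interval[of \<alpha> "\<alpha> - 1"] \<alpha> by simp
    have "(?P \<longlongrightarrow> (1 - 0)\<^sup>2 / (2 * \<alpha> * 1 powr (2 * \<alpha>)) + (G 1 - L)) (at_left 1)"
    proof (intro tendsto_intros)
      show "((\<lambda>t::real. (1 - t) powr \<alpha>) \<longlongrightarrow> 0) (at_left 1)"
        using \<alpha> by real_asymp
      show "(G \<longlongrightarrow> G 1) (at_left 1)"
        using DERIV_isCont[OF G[of 1]] unfolding isCont_def by (auto intro: tendsto_within_subset)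
      have "filterlim (\<lambda>t::real. t / (1 - t)) at_top (at_left 1)"
        by real_asymp
      then show "((\<lambda>t. G (t / (1 - t))) \<longlongrightarrow> L) (at_left 1)"
        by (rule filterlim_compose[OF L])
    qed (use \<alpha> in auto)
    then show "((?P \<circ> real_of_ereal) \<longlongrightarrow> 1 / (2 * \<alpha>) + (G 1 - L)) (at_left (ereal 1))"
      unfolding ereal_tendsto_simps by simp
    have "(?P \<longlongrightarrow> 0 + 0) (at_right 0)"
      by (intro tendsto_add folded_primitive_at_zero primitive_gap_at_zero[OF \<alpha> G] \<alpha>)
    then show "((?P \<circ> real_of_ereal) \<longlongrightarrow> 0) (at_right (ereal 0))"
      unfolding ereal_tendsto_simps by simp
  qed simp
  then have "(LBINT t=ereal 0..ereal 1. integrand \<alpha> (\<alpha> - 1) t) = (1 / (2 * \<alpha>) + (G 1 - L)) - 0"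
    by (subst interval_integral_cong[where g = ?f]) (auto simp: eq)
  then show ?thesis
    by (simp add: interval_lebesgue_integral_def)
qed

lemma C_at_critical_exponent:
  fixes \<alpha> :: real
  assumes \<alpha>: "0 < \<alpha>" "\<alpha> < 1"
  shows "C \<alpha> (\<alpha> - 1) = 0"
proof -
  obtain G where G: "\<And>t. t > 0 \<Longrightarrow> (G has_real_derivative right_increment \<alpha> t) (at t)"
    using einterval_antiderivative[of 0 \<infinity> "right_increment \<alpha>"] isCont_right_increment
    by (auto simp: has_real_derivative_iff_has_vector_derivative zero_ereal_def)
  obtain L where L: "(G \<longlongrightarrow> L) at_top"
    using primitive_tail_limit[OF \<alpha> G] by blast
  show ?thesis
    using \<alpha> integral_below_one[OF \<alpha> G L] integral_above_one[OF \<alpha> G L] by (simp add: C_split)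
qed

theorem proposition1p2:
  fixes \<alpha> :: real
  assumes "\<alpha> \<in> {0<..<1}"
  shows "tau0 \<alpha> = \<alpha> - 1"
  unfolding tau0_def
proof (rule the_equality)
  have \<alpha>: "0 < \<alpha>" "\<alpha> < 1" using assms by auto
  note zero = C_at_critical_exponent[OF \<alpha>]
  show "\<alpha> - 1 \<in> {-1<..<0} \<and> C \<alpha> (\<alpha> - 1) = 0"
    using \<alpha> zero by simp
  fix \<tau> assume \<tau>: "\<tau> \<in> {-1<..<0} \<and> C \<alpha> \<tau> = 0"
  show "\<tau> = \<alpha> - 1"
    using C_neg_right_of_zero[OF \<alpha>, of "\<alpha> - 1" \<tau>] C_neg_right_of_zero[OF \<alpha>, of \<tau> "\<alpha> - 1"] \<alpha> \<tau> zero
    by (cases \<tau> "\<alpha> - 1" rule: linorder_cases) auto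
qed

end
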